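(* Let $(\mathcal{A},\mathcal{Q})$ be a signed Euclidean reconstruction of $\mathcal{P}$ with $m>2$ cameras with pairwise distinct centers, $A_1=[\,I\ \ \mathbf{0}\,]$, signs $\sigma_1,\ldots,\sigma_m$, and $\mathcal{Q}=\{\mathbf{q}_1,\ldots,\mathbf{q}_n\}$. There exists a chiral Euclidean reconstruction of $\mathcal{P}$ that is projectively equivalent to $(\mathcal{A},\mathcal{Q})$ if and only if $\sigma_i=\sigma_j$ for all $1\le i<j\le m$ and either $q_{k4}\ge0$ for all $k$ or $q_{k4}\le0$ for all $k$.
   Context: $\mathbb{P}^3=(\mathbb{R}^4\setminus\{0\})/\!\sim$ is real projective space with the quotient topology. A point is finite if its fourth coordinate is nonzero; $\mathbf{n}_\infty=(0,0,0,1)^\top$. A camera is a rank-3 matrix $A=[\,G\ \ \mathbf{t}\,]\in\mathbb{R}^{3\times4}$, finite if $\det G\ne0$. The center of a finite camera is $\mathbf{c}_A=(-G^{-1}\mathbf{t};\,1)$ and its principal ray is $\mathbf{n}_A=\det(G)A_{3,\bullet}^\top\in\mathbb{R}^4$ ($A_{3,\bullet}$ the third row); $\mathbf{n}_i=\mathbf{n}_{A_i}$. For finite $\mathbf{q}$, $\operatorname{depth}(\mathbf{q};A)=\frac{1}{|\det G|\,\|G_{3,\bullet}\|}\cdot\frac{\mathbf{n}_A^\top\mathbf{q}}{\mathbf{n}_\infty^\top\mathbf{q}}$. The chiral domain $D_\mathcal{A}\subseteq\mathbb{P}^3$ is the closure of the set of finite points having positive depth in every camera of $\mathcal{A}$.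 Let $n\ge1$ and $\mathcal{P}=\{(\mathbf{p}_{1k},\ldots,\mathbf{p}_{mk})\in(\mathbb{R}^2)^m: k=1,\ldots,n\}$; write $\widehat{\mathbf{p}}=(\mathbf{p},1)$. A projective reconstruction of $\mathcal{P}$ is a pair $(\mathcal{A},\mathcal{Q})$ of finite cameras $\mathcal{A}=\{A_1,\ldots,A_m\}$ and points $\mathcal{Q}=\{\mathbf{q}_1,\ldots,\mathbf{q}_n\}\subseteq\mathbb{R}^4\setminus\{0\}$ with $A_i\mathbf{q}_k=w_{ik}\widehat{\mathbf{p}}_{ik}$ for some nonzero scalars $w_{ik}$. It is chiral if $\mathbf{q}_k\in D_\mathcal{A}$ for all $k$; signed if for each $i$ there is $\sigma_i\in\{-1,1\}$ with $\operatorname{sign}(\mathbf{n}_i^\top\mathbf{q}_k)=\sigma_i$ for all $k$; Euclidean if each camera has the form $[\,R\ \ \mathbf{t}\,]$ with $R\in SO(3)$. A reconstruction is projectively equivalent to $(\mathcal{A},\mathcal{Q})$ if for some $H\in\mathrm{GL}_4(\mathbb{R})$ its points are $H\mathbf{q}_k$ and its cameras are $s_iA_iH^{-1}$ with nonzero scalars $s_i$ (rescaling a camera does not change chirality). $q_{k4}$ is the fourth coordinate of $\mathbf{q}_k$. *)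

theory Defs
  imports "HOL-Analysis.Analysis"
begin

subsection \<open>Real projective space with the quotient topology\<close>

definition proj_rel :: "((real^4) \<times> (real^4)) set" where
  "proj_rel = {(x, y). x \<noteq> 0 \<and> y \<noteq> 0 \<and> (\<exists>c. c \<noteq> 0 \<and> y = c *\<^sub>R x)}"

definition P3 :: "(real^4) set set" where
  "P3 = (- {0}) // proj_rel"

definition proj_pt :: "real^4 \<Rightarrow> (real^4) set" where
  "proj_pt x = proj_rel `` {x}"

definition P3_topology :: "(real^4) set topology" where
  "P3_topology = topology (\<lambda>U. U \<subseteq> P3 \<and>
     openin (top_of_set (- {0})) {x \<in> - {0}. proj_pt x \<in> U})"

lemma equiv_proj_rel: "equiv (- {0}) proj_rel"
proof (rule equivI)
  show "proj_rel \<subseteq> (- {0}) \<times> (- {0})"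
    by (auto simp: proj_rel_def)
  show "refl_on (- {0}) proj_rel"
    by (auto simp: proj_rel_def refl_on_def intro: exI[of _ 1])
  show "sym proj_rel"
    unfolding sym_def proj_rel_def
  proof clarsimp
    fix x :: "real^4" and c :: real
    assume "c \<noteq> 0"
    then show "\<exists>d. d \<noteq> 0 \<and> x = (d * c) *\<^sub>R x"
      by (intro exI[of _ "inverse c"]) simp
  qed
  show "trans proj_rel"
  proof (rule transI)
    fix x y z
    assume "(x, y) \<in> proj_rel" "(y, z) \<in> proj_rel"
    then obtain c d where "x \<noteq> 0" "z \<noteq> 0" "c \<noteq> 0" "d \<noteq> 0" "z = (d * c) *\<^sub>R x"
      by (auto simp: proj_rel_def)
    then show "(x, z) \<in> proj_rel"
      by (auto simp: proj_rel_def intro!: exI[of _ "d * c"])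
  qed
qed

lemma proj_pt_eq_iff:
  assumes "x \<noteq> 0" "y \<noteq> 0"
  shows "proj_pt x = proj_pt y \<longleftrightarrow> (\<exists>c. c \<noteq> 0 \<and> y = c *\<^sub>R x)"
  using eq_equiv_class_iff[OF equiv_proj_rel, of x y] assms
  by (auto simp: proj_pt_def proj_rel_def)

lemma P3_eq: "P3 = proj_pt ` (- {0})"
  by (auto simp: P3_def proj_pt_def quotient_def)

lemma openin_P3_topology:
  "openin P3_topology U \<longleftrightarrow>
     U \<subseteq> P3 \<and> openin (top_of_set (- {0})) {x \<in> - {0}. proj_pt x \<in> U}"
proof -
  have "istopology (\<lambda>U. U \<subseteq> P3 \<and>
          openin (top_of_set (- {0})) {x \<in> - {0}. proj_pt x \<in> U})"
    unfolding istopology_def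
  proof (intro conjI allI impI)
    fix S T
    assume "S \<subseteq> P3 \<and> openin (top_of_set (- {0})) {x \<in> - {0}. proj_pt x \<in> S}"
      and "T \<subseteq> P3 \<and> openin (top_of_set (- {0})) {x \<in> - {0}. proj_pt x \<in> T}"
    moreover have "{x \<in> - {0}. proj_pt x \<in> S \<inter> T} =
        {x \<in> - {0}. proj_pt x \<in> S} \<inter> {x \<in> - {0}. proj_pt x \<in> T}"
      by auto
    ultimately show "S \<inter> T \<subseteq> P3"
      and "openin (top_of_set (- {0})) {x \<in> - {0}. proj_pt x \<in> S \<inter> T}"
      by (auto intro: openin_Int)
  next
    fix K
    assume K: "\<forall>S\<in>K. S \<subseteq> P3 \<and>
        openin (top_of_set (- {0})) {x \<in> - {0}. proj_pt x \<in> S}"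
    then show "\<Union>K \<subseteq> P3"
      by auto
    have "{x \<in> - {0}. proj_pt x \<in> \<Union>K} = (\<Union>S\<in>K. {x \<in> - {0}. proj_pt x \<in> S})"
      by auto
    moreover have "openin (top_of_set (- {0})) (\<Union>S\<in>K. {x \<in> - {0}. proj_pt x \<in> S})"
      using K by (intro openin_Union) blast
    ultimately show "openin (top_of_set (- {0})) {x \<in> - {0}. proj_pt x \<in> \<Union>K}"
      by (simp only:)
  qed
  then show ?thesis
    by (simp add: P3_topology_def)
qed

lemma topspace_P3_topology: "topspace P3_topology = P3"
proof -
  have "{x \<in> - {0}. proj_pt x \<in> P3} = - {0}"
    by (auto simp: P3_eq)
  then have "openin P3_topology P3"
    unfolding openin_P3_topology by (simp only: openin_subtopology_self order_refl simp_thms)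
  then show ?thesis
    by (metis openin_P3_topology openin_subset openin_topspace subset_antisym)
qed

lemma quotient_map_proj_pt: "quotient_map (top_of_set (- {0})) P3_topology proj_pt"
  unfolding quotient_map_def
  by (simp add: topspace_P3_topology P3_eq openin_P3_topology)


subsection \<open>Cameras\<close>

definition append4 :: "real^3 \<Rightarrow> real \<Rightarrow> real^4" where
  "append4 x s = (\<chi> j. if j = 1 then x $ 1 else if j = 2 then x $ 2
                       else if j = 3 then x $ 3 else s)"

text \<open>The \<open>3 \<times> 4\<close> block matrix \<open>[G t]\<close>.\<close>

definition block :: "real^3^3 \<Rightarrow> real^3 \<Rightarrow> real^4^3" where
  "block G t = (\<chi> i. append4 (G $ i) (t $ i))"

definition left_block :: "real^4^3 \<Rightarrow> real^3^3" where
  "left_block A = (\<chi> i j. A $ i $ (if j = 1 then 1 else if j = 2 then 2 else 3))"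

definition last_column :: "real^4^3 \<Rightarrow> real^3" where
  "last_column A = column 4 A"

lemma append4_nth [simp]:
  "append4 x s $ 1 = x $ 1" "append4 x s $ 2 = x $ 2"
  "append4 x s $ 3 = x $ 3" "append4 x s $ 4 = s"
  by (simp_all add: append4_def)

lemma block_left_block_last_column: "block (left_block A) (last_column A) = A"
  by (simp add: vec_eq_iff forall_3 forall_4 block_def left_block_def last_column_def column_def)

lemma left_block_block [simp]: "left_block (block G t) = G"
  by (simp add: vec_eq_iff forall_3 block_def left_block_def)

lemma last_column_block [simp]: "last_column (block G t) = t"
  by (simp add: vec_eq_iff block_def last_column_def column_def)

definition camera :: "real^4^3 \<Rightarrow> bool" where
  "camera A \<longleftrightarrow> rank A = 3"

definition finite_camera :: "real^4^3 \<Rightarrow> bool" where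
  "finite_camera A \<longleftrightarrow> camera A \<and> det (left_block A) \<noteq> 0"

text \<open>Meaningful for finite cameras only.\<close>

definition center :: "real^4^3 \<Rightarrow> real^4" where
  "center A = append4 (- (matrix_inv (left_block A) *v last_column A)) 1"

definition principal_ray :: "real^4^3 \<Rightarrow> real^4" where
  "principal_ray A = det (left_block A) *\<^sub>R row 3 A"


subsection \<open>Depth and the chiral domain\<close>

definition n_inf :: "real^4" where
  "n_inf = append4 0 1"

definition finite_point :: "real^4 \<Rightarrow> bool" where
  "finite_point q \<longleftrightarrow> q $ 4 \<noteq> 0"

definition depth :: "real^4 \<Rightarrow> real^4^3 \<Rightarrow> real" where
  "depth q A = 1 / (\<bar>det (left_block A)\<bar> * norm (row 3 (left_block A)))
                 * ((principal_ray A \<bullet> q) / (n_inf \<bullet> q))"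

text \<open>Hence \<^const>\<open>depth\<close> is a function of the projective point.\<close>

lemma depth_scaleR: "c \<noteq> 0 \<Longrightarrow> depth (c *\<^sub>R q) A = depth q A"
  by (simp add: depth_def)

definition chiral_domain :: "(real^4^3) set \<Rightarrow> (real^4) set set" where
  "chiral_domain \<A> = P3_topology closure_of
     {proj_pt q | q. finite_point q \<and> (\<forall>A\<in>\<A>. depth q A > 0)}"


subsection \<open>Reconstructions\<close>

text \<open>
  Cameras, points and image data are families indexed by \<open>i \<in> {1..m}\<close> and \<open>k \<in> {1..n}\<close>;
  \<open>p i k\<close> is the image of the \<open>k\<close>-th point in the \<open>i\<close>-th camera.
\<close>

definition hat :: "real^2 \<Rightarrow> real^3" where
  "hat p = vector [p $ 1, p $ 2, 1]"

definition reconstruction ::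
  "nat \<Rightarrow> nat \<Rightarrow> (nat \<Rightarrow> nat \<Rightarrow> real^2) \<Rightarrow> (nat \<Rightarrow> real^4^3) \<Rightarrow> (nat \<Rightarrow> real^4) \<Rightarrow> bool" where
  "reconstruction m n p A q \<longleftrightarrow>
     (\<forall>i\<in>{1..m}. finite_camera (A i)) \<and>
     (\<forall>k\<in>{1..n}. q k \<noteq> 0) \<and>
     (\<forall>i\<in>{1..m}. \<forall>k\<in>{1..n}. \<exists>w. w \<noteq> 0 \<and> A i *v q k = w *\<^sub>R hat (p i k))"

definition chiral :: "nat \<Rightarrow> nat \<Rightarrow> (nat \<Rightarrow> real^4^3) \<Rightarrow> (nat \<Rightarrow> real^4) \<Rightarrow> bool" where
  "chiral m n A q \<longleftrightarrow> (\<forall>k\<in>{1..n}. proj_pt (q k) \<in> chiral_domain (A ` {1..m}))"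

text \<open>A reconstruction is signed if this holds for some \<open>\<sigma>\<close>.\<close>

definition signed_with ::
  "nat \<Rightarrow> nat \<Rightarrow> (nat \<Rightarrow> real) \<Rightarrow> (nat \<Rightarrow> real^4^3) \<Rightarrow> (nat \<Rightarrow> real^4) \<Rightarrow> bool" where
  "signed_with m n \<sigma> A q \<longleftrightarrow>
     (\<forall>i\<in>{1..m}. \<sigma> i \<in> {-1, 1} \<and> (\<forall>k\<in>{1..n}. sgn (principal_ray (A i) \<bullet> q k) = \<sigma> i))"

definition euclidean_reconstruction :: "nat \<Rightarrow> (nat \<Rightarrow> real^4^3) \<Rightarrow> bool" where
  "euclidean_reconstruction m A \<longleftrightarrow> (\<forall>i\<in>{1..m}. \<exists>R t. rotation_matrix R \<and> A i = block R t)"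

definition projectively_equivalent ::
  "nat \<Rightarrow> nat \<Rightarrow> (nat \<Rightarrow> real^4^3) \<Rightarrow> (nat \<Rightarrow> real^4) \<Rightarrow>
   (nat \<Rightarrow> real^4^3) \<Rightarrow> (nat \<Rightarrow> real^4) \<Rightarrow> bool" where
  "projectively_equivalent m n A' q' A q \<longleftrightarrow>
     (\<exists>H :: real^4^4. invertible H \<and>
        (\<forall>k\<in>{1..n}. q' k = H *v q k) \<and>
        (\<forall>i\<in>{1..m}. \<exists>s. s \<noteq> 0 \<and> A' i = s *\<^sub>R (A i ** matrix_inv H)))"

end

theory Submission
  imports Defs
begin

text \<open>
  Write \<open>n\<^sub>i\<close> for the principal ray of the \<open>i\<close>-th camera. For finite cameras, depth is positive
  exactly when \<open>(n\<^sub>i \<bullet> x) x\<^sub>4 > 0\<close>, so on the chiral domain the numbers \<open>n\<^sub>i \<bullet> x\<close> and \<open>x\<^sub>4\<close> have,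
  up to zeros, one common sign. Conversely, if all \<open>n\<^sub>i \<bullet> x\<close> have the same strict sign and \<open>x\<^sub>4\<close>
  does not have the opposite one, then a small change of \<open>x\<^sub>4\<close> makes all depths positive. These
  two halves are \<open>chiral_domain_same_sign\<close> and \<open>chiral_domain_if_same_sign\<close>.

  The other ingredient is rigidity: a projective map between two Euclidean reconstructions must
  be affine as soon as there are three distinct centers (\<open>euclidean_equivalence_is_affine\<close>).
  Let \<open>K\<close> be the inverse of the map, with bottom row \<open>(v, d)\<close>, and let \<open>f\<close> be its upper left block;
  as the first camera is \<open>[I 0]\<close>, \<open>f\<close> is a multiple of a rotation. A camera with center \<open>c\<close>
  is turned into one whose left block is \<open>x \<mapsto> f x - (v \<bullet> x) c\<close>, up to a rotation and a scalar, and
  the new camera is Euclidean only if this is a similarity too. If \<open>v \<noteq> 0\<close>, this rank-one change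
  of a similarity is again a similarity for only one nonzero \<open>c\<close>: the change composes \<open>f\<close> with a reflection, which is the classical
  twisted pair of two cameras. Two distinct centers away from the first one therefore force
  \<open>v = 0\<close>. Then all the camera scales agree, because rotations have determinant one.

  Hence an equivalent Euclidean reconstruction multiplies all \<open>n\<^sub>i \<bullet> q\<^sub>k\<close> by one common nonzero
  scalar and all \<open>q\<^bsub>k4\<^esub>\<close> by another. Chirality thus asks that the \<open>\<sigma>\<^sub>i\<close> agree and that the \<open>q\<^bsub>k4\<^esub>\<close>
  do not have opposite signs. When this holds, at most one sign is left to be repaired, and
  changing the sign of the fourth coordinate in space does it: this keeps the cameras Euclidean
  and does not change \<open>n\<^sub>i \<bullet> q\<^sub>k\<close>.
\<close>

section \<open>Points of the chiral domain\<close>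

lemma depth_pos_iff:
  assumes "finite_camera A"
  shows "depth q A > 0 \<longleftrightarrow> (principal_ray A \<bullet> q) * q $ 4 > 0"
proof -
  have "det (left_block A) \<noteq> 0"
    using assms by (simp add: finite_camera_def)
  moreover from this have "row 3 (left_block A) \<noteq> 0"
    using det_zero_row by blast
  moreover have "n_inf \<bullet> q = q $ 4"
    by (simp add: n_inf_def inner_vec_def sum_4)
  ultimately show ?thesis
    by (simp add: depth_def zero_less_divide_iff zero_less_mult_iff[of "principal_ray A \<bullet> q"])
      (simp add: zero_less_mult_iff mult_less_0_iff)
qed

text \<open>
  A quadratic homogeneous function has a well-defined sign at a projective point, so for
  continuous \<open>f\<close> the condition \<open>f x \<ge> 0\<close> is closed in projective space and passes from the points
  of positive depth to their closure.
\<close>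

lemma chiral_domain_nonneg:
  fixes f :: "real^4 \<Rightarrow> real"
  assumes cont: "continuous_on UNIV f"
    and hom: "\<And>c x. f (c *\<^sub>R x) = c\<^sup>2 * f x"
    and pos: "\<And>x. finite_point x \<Longrightarrow> \<forall>A\<in>\<A>. depth x A > 0 \<Longrightarrow> f x \<ge> 0"
    and q: "q \<noteq> 0" "proj_pt q \<in> chiral_domain \<A>"
  shows "f q \<ge> 0"
proof (rule ccontr)
  assume neg: "\<not> f q \<ge> 0"
  define U where "U = proj_pt ` {x \<in> - {0}. f x < 0}"
  have "{x \<in> - {0}. proj_pt x \<in> U} = {x \<in> - {0}. f x < 0}"
  proof (safe)
    fix x :: "real^4"
    assume "x \<noteq> 0" "proj_pt x \<in> U"
    then obtain y c where "f y < 0" "c \<noteq> 0" "y = c *\<^sub>R x"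
      unfolding U_def using proj_pt_eq_iff by blast
    then show "f x < 0"
      by (simp add: hom mult_less_0_iff)
  qed (auto simp: U_def)
  moreover have "open ((- {0}) \<inter> f -` {..<0})"
    using open_vimage[OF open_lessThan cont] by (intro open_Int) auto
  moreover have "{x \<in> - {0}. f x < 0} = (- {0}) \<inter> f -` {..<0}"
    by auto
  ultimately have "openin (top_of_set (- {0})) {x \<in> - {0}. proj_pt x \<in> U}"
    by (simp add: open_subset)
  then have "openin P3_topology U"
    by (auto simp: openin_P3_topology U_def P3_eq)
  moreover have "proj_pt q \<in> U"
    using q neg by (auto simp: U_def)
  ultimately obtain x where "finite_point x" "\<forall>A\<in>\<A>. depth x A > 0" "proj_pt x \<in> U"
    using q(2) unfolding chiral_domain_def in_closure_of by blast
  moreover from this have "x \<noteq> 0"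
    by (auto simp: finite_point_def)
  ultimately obtain c where "f (c *\<^sub>R x) < 0" "f x \<ge> 0"
    unfolding U_def using proj_pt_eq_iff pos by blast
  then show False
    by (simp add: hom mult_less_0_iff)
qed

text \<open>
  Equality of signs is not a closed condition, but nonnegativity of the products is, and it
  implies equality wherever the factors do not vanish.
\<close>

lemma chiral_domain_same_sign:
  assumes cam: "\<And>A. A \<in> \<A> \<Longrightarrow> finite_camera A"
    and q: "q \<noteq> 0" "proj_pt q \<in> chiral_domain \<A>" and AB: "A \<in> \<A>" "B \<in> \<A>"
  shows "(principal_ray A \<bullet> q) * (principal_ray B \<bullet> q) \<ge> 0"
    and "(principal_ray A \<bullet> q) * q $ 4 \<ge> 0"
proof -
  have pos: "(principal_ray C \<bullet> x) * x $ 4 > 0" if "\<forall>A\<in>\<A>. depth x A > 0" "C \<in> \<A>" for x C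
    using that cam depth_pos_iff by blast
  show "(principal_ray A \<bullet> q) * (principal_ray B \<bullet> q) \<ge> 0"
  proof (rule chiral_domain_nonneg[OF _ _ _ q])
    fix x assume "\<forall>A\<in>\<A>. depth x A > 0"
    from pos[OF this AB(1)] pos[OF this AB(2)]
    show "(principal_ray A \<bullet> x) * (principal_ray B \<bullet> x) \<ge> 0"
      by (auto simp: zero_less_mult_iff intro: mult_nonpos_nonpos)
  qed (auto intro!: continuous_intros simp: power2_eq_square)
  show "(principal_ray A \<bullet> q) * q $ 4 \<ge> 0"
  proof (rule chiral_domain_nonneg[OF _ _ _ q])
    fix x assume "\<forall>A\<in>\<A>. depth x A > 0"
    from pos[OF this AB(1)] show "(principal_ray A \<bullet> x) * x $ 4 \<ge> 0"
      by (rule less_imp_le)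
  qed (auto intro!: continuous_intros simp: power2_eq_square)
qed

lemma proj_pt_in_chiral_domain:
  assumes "q \<noteq> 0" "q \<in> closure {x. finite_point x \<and> (\<forall>A\<in>\<A>. depth x A > 0)}"
  shows "proj_pt q \<in> chiral_domain \<A>"
  unfolding chiral_domain_def in_closure_of
proof (intro conjI allI impI)
  show "proj_pt q \<in> topspace P3_topology"
    using assms by (simp add: topspace_P3_topology P3_eq)
next
  fix T assume T: "proj_pt q \<in> T \<and> openin P3_topology T"
  define V where "V = {x \<in> - {0}. proj_pt x \<in> T}"
  have "open V"
    using T openin_open_trans[of "- {0}" V] by (auto simp: openin_P3_topology V_def)
  moreover have "q \<in> V"
    using T assms by (simp add: V_def)
  ultimately obtain x where "x \<in> V" "finite_point x" "\<forall>A\<in>\<A>. depth x A > 0"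
    using assms(2) open_Int_closure_eq_empty[OF \<open>open V\<close>] by blast
  then show "\<exists>y. y \<in> {proj_pt q |q. finite_point q \<and> (\<forall>A\<in>\<A>. 0 < depth q A)} \<and> y \<in> T"
    by (auto simp: V_def)
qed

text \<open>
  Moving \<open>q\<close> a little in the direction \<open>\<tau>\<close> along the fourth axis makes \<open>\<tau> q\<^sub>4\<close> positive even if
  it was zero, while the finitely many strict inequalities \<open>sign\<close> survive.
\<close>

lemma chiral_domain_if_same_sign:
  assumes "finite \<A>" and "\<tau> \<noteq> 0" and "q \<noteq> 0"
    and cam: "\<And>A. A \<in> \<A> \<Longrightarrow> finite_camera A"
    and sign: "\<And>A. A \<in> \<A> \<Longrightarrow> \<tau> * (principal_ray A \<bullet> q) > 0"
    and q4: "\<tau> * q $ 4 \<ge> 0"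
  shows "proj_pt q \<in> chiral_domain \<A>"
proof (rule proj_pt_in_chiral_domain[OF \<open>q \<noteq> 0\<close>])
  define x where "x t = q + (t * \<tau>) *\<^sub>R axis 4 1" for t
  let ?C = "{x. finite_point x \<and> (\<forall>A\<in>\<A>. depth x A > 0)}"
  have lim: "(x \<longlongrightarrow> q) (at_right 0)"
    unfolding x_def by (rule tendsto_eq_intros refl | simp)+
  have "\<forall>\<^sub>F t in at_right 0. \<tau> * (principal_ray A \<bullet> x t) > 0" if "A \<in> \<A>" for A
  proof (rule order_tendstoD(1))
    show "((\<lambda>t. \<tau> * (principal_ray A \<bullet> x t)) \<longlongrightarrow> \<tau> * (principal_ray A \<bullet> q)) (at_right 0)"
      by (intro tendsto_intros lim)
  qed (rule sign[OF that])
  then have "\<forall>\<^sub>F t in at_right 0. \<forall>A\<in>\<A>. \<tau> * (principal_ray A \<bullet> x t) > 0"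
    using \<open>finite \<A>\<close> by (simp add: eventually_ball_finite_distrib)
  moreover have "\<forall>\<^sub>F t in at_right (0::real). t > 0"
    by (simp add: eventually_at_right_less)
  ultimately have "\<forall>\<^sub>F t in at_right 0. x t \<in> ?C"
  proof eventually_elim
    case (elim t)
    have "\<tau> * x t $ 4 = \<tau> * q $ 4 + t * \<tau>\<^sup>2"
      by (simp add: x_def axis_def algebra_simps power2_eq_square)
    also have "\<dots> > 0"
      using q4 elim \<open>\<tau> \<noteq> 0\<close> by (simp add: add_nonneg_pos)
    finally have x4: "\<tau> * x t $ 4 > 0" .
    have "(principal_ray A \<bullet> x t) * x t $ 4 > 0" if "A \<in> \<A>" for A
      using x4 elim that by (fastforce simp: zero_less_mult_iff)
    then show ?case
      using x4 by (auto simp: finite_point_def depth_pos_iff cam)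
  qed
  then have "\<forall>\<^sub>F t in at_right 0. x t \<in> closure ?C"
    by eventually_elim (rule subsetD[OF closure_subset])
  then show "q \<in> closure ?C"
    using lim by (intro Lim_in_closed_set[of "closure ?C" x "at_right 0"]) auto
qed

section \<open>Rank-one perturbations of similarities\<close>

text \<open>
  On the hyperplane orthogonal to \<open>v\<close>, which is nonzero because the dimension is at least two,
  both maps agree, so their scale factors are equal. Comparing the squared norms of the two
  images of \<open>x\<close> then gives the conclusion multiplied by \<open>v \<bullet> x\<close>. Both sides of the conclusion
  are linear in \<open>x\<close>, so it extends to the hyperplane \<open>v \<bullet> x = 0\<close>.
\<close>

lemma conformal_rank_one_update:
  fixes f :: "'a::euclidean_space \<Rightarrow> 'b::real_inner"
  assumes "2 \<le> DIM('a)" and "linear f" and "v \<noteq> 0"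
    and f: "\<And>x. norm (f x) = a * norm x"
    and g: "\<And>x. norm (f x - (v \<bullet> x) *\<^sub>R c) = b * norm x"
  shows "(v \<bullet> x) * (c \<bullet> c) = 2 * (f x \<bullet> c)"
proof -
  obtain y where "y \<noteq> 0" "v \<bullet> y = 0"
    using orthogonal_to_vector_exists[OF assms(1), of v] by (auto simp: orthogonal_def)
  with f[of y] g[of y] have "a = b"
    by simp
  then have "norm (f x - (v \<bullet> x) *\<^sub>R c) = norm (f x)" for x
    using f g by simp
  then have sq: "(f x - (v \<bullet> x) *\<^sub>R c) \<bullet> (f x - (v \<bullet> x) *\<^sub>R c) = f x \<bullet> f x" for x
    by (simp add: norm_eq)
  have "(v \<bullet> x) * ((v \<bullet> x) * (c \<bullet> c) - 2 * (f x \<bullet> c)) = 0" for x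
    using sq[of x]
    by (simp add: algebra_simps inner_commute)
  then have *: "(v \<bullet> x) * (c \<bullet> c) = 2 * (f x \<bullet> c)" if "v \<bullet> x \<noteq> 0" for x
    using that by (metis eq_iff_diff_eq_0 mult_eq_0_iff)
  show ?thesis
  proof (cases "v \<bullet> x = 0")
    case True
    have "(v \<bullet> v) * (c \<bullet> c) = 2 * (f v \<bullet> c)"
      and "(v \<bullet> (x + v)) * (c \<bullet> c) = 2 * (f (x + v) \<bullet> c)"
      using True \<open>v \<noteq> 0\<close> by (intro *; simp add: inner_right_distrib)+
    then show ?thesis
      using True by (simp add: linear_add[OF \<open>linear f\<close>] inner_left_distrib inner_right_distrib)
  qed (rule *)
qed

text \<open>
  If \<open>v \<noteq> 0\<close>, the previous identity determines the inner products of every \<open>f x\<close> with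
  \<open>c / (c \<bullet> c)\<close>, hence this vector itself. It is the image of \<open>c\<close> under the inversion in the
  unit sphere, which is injective away from zero.
\<close>

lemma conformal_rank_one_update_unique:
  fixes f :: "'a::euclidean_space \<Rightarrow> 'b::real_inner"
  assumes "2 \<le> DIM('a)" and "linear f" and "surj f"
    and f: "\<And>x. norm (f x) = a * norm x"
    and c: "c \<noteq> 0" "\<And>x. norm (f x - (v \<bullet> x) *\<^sub>R c) = b * norm x"
    and c': "c' \<noteq> 0" "\<And>x. norm (f x - (v \<bullet> x) *\<^sub>R c') = b' * norm x"
    and "c \<noteq> c'"
  shows "v = 0"
proof (rule ccontr)
  assume "v \<noteq> 0"
  \<comment> \<open>Inversion in the unit sphere, an involution on nonzero vectors.\<close>
  define h where "h z = z /\<^sub>R (z \<bullet> z)" for z :: 'b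
  have "2 * (f x \<bullet> h c) = v \<bullet> x" "2 * (f x \<bullet> h c') = v \<bullet> x" for x
    using conformal_rank_one_update[OF assms(1,2) \<open>v \<noteq> 0\<close> f c(2), of x]
      conformal_rank_one_update[OF assms(1,2) \<open>v \<noteq> 0\<close> f c'(2), of x] c(1) c'(1)
    by (simp_all add: h_def field_simps)
  then have "f x \<bullet> (h c - h c') = 0" for x
    by (smt (verit) inner_diff_right)
  with \<open>surj f\<close> have "(h c - h c') \<bullet> (h c - h c') = 0"
    by (metis surjD)
  then have "h c = h c'"
    by simp
  moreover have "z = h (h z)" if "z \<noteq> 0" for z
    using that by (simp add: h_def)
  ultimately show False
    using c(1) c'(1) \<open>c \<noteq> c'\<close> by metis
qed

section \<open>Euclidean cameras\<close>

lemma left_block_mult: "left_block A *v x = A *v append4 x 0"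
  by (simp add: vec_eq_iff matrix_vector_mult_def left_block_def sum_3 sum_4)

lemma block_mult: "block G t *v append4 x s = G *v x + s *\<^sub>R t"
  by (simp add: vec_eq_iff matrix_vector_mult_def block_def sum_3 sum_4)

lemma append4_eq_iff: "append4 x s = append4 y t \<longleftrightarrow> x = y \<and> s = t"
  by (auto simp: vec_eq_iff forall_3 forall_4)

lemma ex_append4: "\<exists>x. y = append4 x (y $ 4)"
  by (rule exI[of _ "vector [y $ 1, y $ 2, y $ 3]"]) (simp add: vec_eq_iff forall_4)

lemma finite_camera_block:
  assumes "det G \<noteq> 0"
  shows "finite_camera (block G t)"
proof -
  obtain G' where G': "G ** G' = mat 1"
    using assms invertible_right_inverse invertible_det_nz by blast
  have "block G t *v append4 (G' *v y) 0 = y" for y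
    by (simp add: block_mult matrix_vector_mul_assoc G')
  then have "surj ((*v) (block G t))"
    unfolding surj_def by metis
  then have "rank (block G t) = 3"
    using full_rank_surjective[of "block G t"] by simp
  then show ?thesis
    using assms by (simp add: finite_camera_def camera_def)
qed

text \<open>
  For a Euclidean camera the determinant in the principal ray is one, so \<open>n \<bullet> x\<close> can be read off
  the image of \<open>x\<close>. This is how its sign is followed through projective equivalences.
\<close>

lemma principal_ray_rotation:
  assumes "rotation_matrix R"
  shows "principal_ray (block R t) \<bullet> x = (block R t *v x) $ 3"
  using assms
  by (simp add: principal_ray_def rotation_matrix_def row_def inner_vec_def matrix_vector_mult_def)

lemma norm_rotation: "rotation_matrix R \<Longrightarrow> norm (R *v x) = norm (x :: real^'n)"
  by (auto simp: rotation_matrix_def orthogonal_transformation_matrix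
      intro!: orthogonal_transformation_norm)

lemma surj_rotation: "rotation_matrix R \<Longrightarrow> surj ((*v) (R :: real^'n^'n))"
  by (auto simp: rotation_matrix_def orthogonal_transformation_matrix
      intro!: orthogonal_transformation_surj)

text \<open>
  Taking determinants gives \<open>r\<^sup>3 = 1\<close>; the odd dimension is what rules out \<open>r = -1\<close>.
\<close>

lemma rotation_matrix_scale_eq_1:
  fixes R S :: "real^3^3"
  assumes "rotation_matrix R" "rotation_matrix S" and RS: "\<And>x. R *v x = r *\<^sub>R (S *v x)"
  shows "r = 1"
proof -
  have "R = r *\<^sub>R S"
    by (simp add: matrix_eq RS scaleR_matrix_vector_assoc[symmetric])
  also have "\<dots> = (\<chi> i. r *s S $ i)"
    by (simp add: vec_eq_iff)
  finally have "det R = r ^ 3 * det S"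
    by (simp add: det_rows_mul)
  then have "r ^ 3 = 1"
    using assms(1,2) by (simp add: rotation_matrix_def)
  then show ?thesis
    using odd_real_root_power_cancel[of 3 r] by simp
qed

lemma matrix_inv_mult:
  fixes A :: "real^'n^'n"
  assumes "invertible A"
  shows "A ** matrix_inv A = mat 1" "matrix_inv A ** A = mat 1"
  using assms someI_ex[of "\<lambda>B. A ** B = mat 1 \<and> B ** A = mat 1"]
  by (auto simp: invertible_def matrix_inv_def)

text \<open>
  With center \<open>c\<close> the camera is \<open>[R (-R c)]\<close>, so that it maps \<open>(x, z)\<close> to \<open>R (x - z c)\<close>.
\<close>

lemma norm_euclidean_camera:
  assumes "rotation_matrix R" and "center (block R t) = append4 c 1"
  shows "norm (block R t *v append4 x z) = norm (x - z *\<^sub>R c)"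
proof -
  have "R ** matrix_inv R = mat 1"
    using assms invertible_det_nz[of R] matrix_inv_mult[of R]
    by (simp add: rotation_matrix_def)
  moreover have "c = - (matrix_inv R *v t)"
    using assms(2) by (simp add: center_def append4_eq_iff)
  ultimately have "R *v c = - t"
    by (simp add: matrix_vector_mul_assoc linear_neg[OF matrix_vector_mul_linear])
  then have "block R t *v append4 x z = R *v (x - z *\<^sub>R c)"
    by (simp add: block_mult matrix_vector_mult_diff_distrib matrix_vector_mult_scaleR)
  then show ?thesis
    by (simp add: norm_rotation[OF assms(1)])
qed

lemma euclidean_cameraE:
  assumes "euclidean_reconstruction m A" "i \<in> {1..m}"
  obtains R t where "rotation_matrix R" "A i = block R t"
  using assms unfolding euclidean_reconstruction_def by metis

text \<open>
  Here \<open>K\<close> is the inverse of the projective map. The first conclusion says that the bottom row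
  of \<open>K\<close> is \<open>(0, d)\<close>, that is, \<open>K\<close> maps the plane at infinity into itself. Distinctness of three centers is
  used to apply \<open>conformal_rank_one_update_unique\<close> to the second and the third one; the first
  one is the origin, where the rank-one term vanishes and \<open>f\<close> itself is seen to be a similarity.
\<close>

lemma euclidean_equivalence_is_affine:
  fixes K :: "real^4^4"
  assumes "m > 2"
    and A: "euclidean_reconstruction m A" and A': "euclidean_reconstruction m A'"
    and distinct: "\<forall>i\<in>{1..m}. \<forall>j\<in>{1..m}. i \<noteq> j \<longrightarrow> center (A i) \<noteq> center (A j)"
    and A1: "A 1 = block (mat 1) 0"
    and s: "\<And>i. i \<in> {1..m} \<Longrightarrow> s i \<noteq> 0 \<and> A' i = s i *\<^sub>R (A i ** K)"
  shows "\<exists>d. \<forall>y. (K *v y) $ 4 = d * y $ 4" and "\<forall>i\<in>{1..m}. s i = s 1"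
proof -
  \<comment> \<open>The blocks of the first three columns of \<open>K\<close>; applying \<open>A 1\<close> drops the fourth coordinate.\<close>
  define f where "f x = A 1 *v (K *v append4 x 0)" for x
  define v :: "real^3" where "v = vector [K $ 4 $ 1, K $ 4 $ 2, K $ 4 $ 3]"
  have A1_mult: "A 1 *v append4 x z = x" for x z
    unfolding A1 by (simp add: block_mult)
  have v: "(K *v append4 x z) $ 4 = v \<bullet> x + K $ 4 $ 4 * z" for x z
    by (simp add: matrix_vector_mult_def inner_vec_def sum_3 sum_4 v_def)
  have K: "K *v append4 x 0 = append4 (f x) (v \<bullet> x)" for x
    using ex_append4[of "K *v append4 x 0"] v[of x 0] by (metis A1_mult add_0_right f_def mult_zero_right)
  have f_eq: "f x = left_block (A 1 ** K) *v x" for x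
    by (simp add: f_def left_block_mult matrix_vector_mul_assoc)
  then have "f = (*v) (left_block (A 1 ** K))"
    by blast
  then have "linear f"
    by simp
  have rot: "\<exists>R. rotation_matrix R \<and> (\<forall>x. R *v x = s i *\<^sub>R (A i *v append4 (f x) (v \<bullet> x)))"
    if i: "i \<in> {1..m}" for i
  proof -
    obtain R t where R: "rotation_matrix R" "A' i = block R t"
      by (rule euclidean_cameraE[OF A' i])
    then have "R *v x = A' i *v append4 x 0" for x
      by (simp add: block_mult)
    then show ?thesis
      using R(1) s[OF i]
      by (auto simp: scaleR_matrix_vector_assoc[symmetric] matrix_vector_mul_assoc[symmetric] K)
  qed
  have norm_f: "norm (f x - (v \<bullet> x) *\<^sub>R c) = inverse \<bar>s i\<bar> * norm x"
    if i: "i \<in> {1..m}" "center (A i) = append4 c 1" for i c x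
  proof -
    obtain R t where "rotation_matrix R" "A i = block R t"
      by (rule euclidean_cameraE[OF A i(1)])
    then have "norm (f x - (v \<bullet> x) *\<^sub>R c) = norm (A i *v append4 (f x) (v \<bullet> x))"
      using norm_euclidean_camera i by simp
    moreover obtain R' where "rotation_matrix R'" "R' *v x = s i *\<^sub>R (A i *v append4 (f x) (v \<bullet> x))"
      using rot i by blast
    then have "norm x = \<bar>s i\<bar> * norm (A i *v append4 (f x) (v \<bullet> x))"
      by (metis norm_rotation norm_scaleR)
    ultimately show ?thesis
      using s[OF i(1)] by simp
  qed
  obtain R1 where R1: "rotation_matrix R1" "\<And>x. R1 *v x = s 1 *\<^sub>R f x"
    using rot[of 1, unfolded A1_mult] \<open>m > 2\<close> by auto
  have "s 1 \<noteq> 0"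
    using s \<open>m > 2\<close> by simp
  have "surj f"
    unfolding surj_def
  proof
    fix y
    obtain x where "s 1 *\<^sub>R y = R1 *v x"
      using surj_rotation[OF R1(1)] by (metis surjD)
    then show "\<exists>x. y = f x"
      using R1(2) \<open>s 1 \<noteq> 0\<close> by auto
  qed
  define c where "c i = - (matrix_inv (left_block (A i)) *v last_column (A i))" for i
  have c: "center (A i) = append4 (c i) 1" for i
    by (simp add: c_def center_def)
  have "c 1 = 0"
    unfolding c_def A1 by simp
  have "c 1 \<noteq> c 2" "c 1 \<noteq> c 3" "c 2 \<noteq> c 3"
    using distinct \<open>m > 2\<close> by (auto simp: c append4_eq_iff)
  with \<open>c 1 = 0\<close> have "v = 0"
    using \<open>m > 2\<close> norm_f[OF _ c, of 1] norm_f[OF _ c, of 2] norm_f[OF _ c, of 3]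
    by (intro conformal_rank_one_update_unique[OF _ \<open>linear f\<close> \<open>surj f\<close>, of "inverse \<bar>s 1\<bar>"
          "c 2" v "inverse \<bar>s 2\<bar>" "c 3" "inverse \<bar>s 3\<bar>"]) auto
  then show "\<exists>d. \<forall>y. (K *v y) $ 4 = d * y $ 4"
    using v ex_append4 by (metis add_0_left append4_nth(4) inner_zero_left)
  show "\<forall>i\<in>{1..m}. s i = s 1"
  proof
    fix i assume i: "i \<in> {1..m}"
    obtain R t where R: "rotation_matrix R" "A i = block R t"
      by (rule euclidean_cameraE[OF A i])
    obtain R' where R': "rotation_matrix R'" "\<And>x. R' *v x = s i *\<^sub>R (R *v f x)"
      using rot[OF i, unfolded R(2) block_mult \<open>v = 0\<close>] by auto
    have "rotation_matrix (R ** R1)"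
      using R(1) R1(1) by (simp add: rotation_matrix_def orthogonal_matrix_mul det_mul)
    moreover have "R' *v x = (s i / s 1) *\<^sub>R ((R ** R1) *v x)" for x
      using \<open>s 1 \<noteq> 0\<close>
      by (simp add: R' R1 matrix_vector_mul_assoc[symmetric] matrix_vector_mult_scaleR)
    ultimately have "s i / s 1 = 1"
      by (intro rotation_matrix_scale_eq_1[OF R'(1)])
    then show "s i = s 1"
      using \<open>s 1 \<noteq> 0\<close> by simp
  qed
qed

section \<open>Scaling the fourth coordinate\<close>

definition scale4 :: "real \<Rightarrow> real^4^4" where
  "scale4 \<epsilon> = (\<chi> i j. if i = j then (if i = 4 then \<epsilon> else 1) else 0)"

lemma scale4_mult: "(scale4 \<epsilon> *v x) $ 4 = \<epsilon> * x $ 4"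
  by (simp add: scale4_def matrix_vector_mult_def sum_4)

lemma scale4_involution: "\<epsilon>\<^sup>2 = 1 \<Longrightarrow> scale4 \<epsilon> ** scale4 \<epsilon> = mat 1"
  by (simp add: vec_eq_iff forall_4 scale4_def matrix_matrix_mult_def mat_def sum_4 power2_eq_square)

lemma block_scale4: "block R t ** scale4 \<epsilon> = block R (\<epsilon> *\<^sub>R t)"
  by (simp add: vec_eq_iff forall_4 scale4_def matrix_matrix_mult_def block_def sum_4)

section \<open>The chirality criterion\<close>

lemma signed_withD:
  assumes "signed_with m n \<sigma> A q" "i \<in> {1..m}" "k \<in> {1..n}"
  shows "\<sigma> i * (principal_ray (A i) \<bullet> q k) > 0" and "(\<sigma> i)\<^sup>2 = 1"
proof -
  have "\<sigma> i \<in> {-1, 1}" "sgn (principal_ray (A i) \<bullet> q k) = \<sigma> i"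
    using assms by (auto simp: signed_with_def)
  then show "\<sigma> i * (principal_ray (A i) \<bullet> q k) > 0" "(\<sigma> i)\<^sup>2 = 1"
    by (auto simp: sgn_1_pos sgn_1_neg zero_less_mult_iff)
qed

text \<open>
  By rigidity the equivalence multiplies all \<open>n\<^sub>i \<bullet> q\<^sub>k\<close> by the same scalar \<open>s 1\<close> and divides all
  \<open>q\<^bsub>k4\<^esub>\<close> by the same \<open>d\<close>, so the sign conditions on the chiral domain pull back to the given
  reconstruction.
\<close>

lemma chiral_equivalent_imp_same_signs:
  assumes "n \<ge> 1" and "m > 2"
    and eucl: "euclidean_reconstruction m A"
    and signed: "signed_with m n \<sigma> A q"
    and distinct: "\<forall>i\<in>{1..m}. \<forall>j\<in>{1..m}. i \<noteq> j \<longrightarrow> center (A i) \<noteq> center (A j)"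
    and A1: "A 1 = block (mat 1) 0"
    and rec: "reconstruction m n p A' q'" and ch: "chiral m n A' q'"
    and eu: "euclidean_reconstruction m A'" and equiv: "projectively_equivalent m n A' q' A q"
  shows "\<forall>i\<in>{1..m}. \<forall>j\<in>{1..m}. \<sigma> i = \<sigma> j"
    and "(\<forall>k\<in>{1..n}. q k $ 4 \<ge> 0) \<or> (\<forall>k\<in>{1..n}. q k $ 4 \<le> 0)"
proof -
  note sign = signed_withD[OF signed]
  from equiv obtain H where H: "invertible H"
    and q': "\<And>k. k \<in> {1..n} \<Longrightarrow> q' k = H *v q k"
    and "\<forall>i\<in>{1..m}. \<exists>s. s \<noteq> 0 \<and> A' i = s *\<^sub>R (A i ** matrix_inv H)"
    unfolding projectively_equivalent_def by blast
  then obtain s where s: "\<And>i. i \<in> {1..m} \<Longrightarrow> s i \<noteq> 0 \<and> A' i = s i *\<^sub>R (A i ** matrix_inv H)"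
    by metis
  obtain d where d: "\<And>y. (matrix_inv H *v y) $ 4 = d * y $ 4"
    using euclidean_equivalence_is_affine(1)[OF \<open>m > 2\<close> eucl eu distinct A1 s] by blast
  have s1: "s i = s 1" if "i \<in> {1..m}" for i
    using euclidean_equivalence_is_affine(2)[OF \<open>m > 2\<close> eucl eu distinct A1 s] that by blast
  have "s 1 \<noteq> 0"
    using s \<open>m > 2\<close> by simp
  have q: "matrix_inv H *v q' k = q k" if "k \<in> {1..n}" for k
    by (simp add: q'[OF that] matrix_vector_mul_assoc matrix_inv_mult[OF H])
  have q4: "q k $ 4 = d * q' k $ 4" if "k \<in> {1..n}" for k
    using d q that by metis
  have ray: "principal_ray (A' i) \<bullet> q' k = s 1 * (principal_ray (A i) \<bullet> q k)"
    if ik: "i \<in> {1..m}" "k \<in> {1..n}" for i k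
  proof -
    obtain R t where R: "rotation_matrix R" "A i = block R t"
      by (rule euclidean_cameraE[OF eucl ik(1)])
    obtain R' t' where R': "rotation_matrix R'" "A' i = block R' t'"
      by (rule euclidean_cameraE[OF eu ik(1)])
    have "A' i *v q' k = s 1 *\<^sub>R (A i *v q k)"
      using s[OF ik(1)] s1[OF ik(1)] q[OF ik(2)]
      by (simp add: scaleR_matrix_vector_assoc[symmetric] matrix_vector_mul_assoc[symmetric])
    then show ?thesis
      using principal_ray_rotation R R' by (metis real_scaleR_def vector_scaleR_component)
  qed
  have same_sign: "(principal_ray (A' i) \<bullet> q' k) * (principal_ray (A' j) \<bullet> q' k) \<ge> 0"
    "(principal_ray (A' i) \<bullet> q' k) * q' k $ 4 \<ge> 0"
    if ijk: "i \<in> {1..m}" "j \<in> {1..m}" "k \<in> {1..n}" for i j k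
  proof -
    have cam: "\<And>B. B \<in> A' ` {1..m} \<Longrightarrow> finite_camera B"
      and q'_chiral: "q' k \<noteq> 0" "proj_pt (q' k) \<in> chiral_domain (A' ` {1..m})"
      using rec ch ijk unfolding reconstruction_def chiral_def by blast+
    note D = chiral_domain_same_sign[OF cam q'_chiral imageI[OF ijk(1)] imageI[OF ijk(2)]]
    show "(principal_ray (A' i) \<bullet> q' k) * (principal_ray (A' j) \<bullet> q' k) \<ge> 0"
      by (rule D(1))
    show "(principal_ray (A' i) \<bullet> q' k) * q' k $ 4 \<ge> 0"
      by (rule D(2))
  qed
  show "\<forall>i\<in>{1..m}. \<forall>j\<in>{1..m}. \<sigma> i = \<sigma> j"
  proof (intro ballI)
    fix i j assume ij: "i \<in> {1..m}" "j \<in> {1..m}"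
    have one: "1 \<in> {1..n}"
      using \<open>n \<ge> 1\<close> by simp
    have "(principal_ray (A i) \<bullet> q 1) * (principal_ray (A j) \<bullet> q 1) \<ge> 0"
      using same_sign(1)[OF ij one] \<open>s 1 \<noteq> 0\<close>
      by (simp only: ray ij one) (auto simp: zero_le_mult_iff mult_le_0_iff)
    then show "\<sigma> i = \<sigma> j"
      using sign[OF ij(1) one] sign[OF ij(2) one]
      by (auto simp: power2_eq_1_iff zero_le_mult_iff zero_less_mult_iff)
  qed
  have one: "1 \<in> {1..m}"
    using \<open>m > 2\<close> by simp
  \<comment> \<open>\<open>e\<close> has the sign that \<open>n\<^sub>1 \<bullet> q\<^sub>k\<close> has, for every \<open>k\<close>, after the equivalence.\<close>
  define e where "e = s 1 * \<sigma> 1"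
  have "e \<noteq> 0"
    using \<open>s 1 \<noteq> 0\<close> sign(2)[OF one, of 1] \<open>n \<ge> 1\<close> by (auto simp: e_def)
  have nonneg: "e * q' k $ 4 \<ge> 0" if k: "k \<in> {1..n}" for k
  proof -
    have "(principal_ray (A' 1) \<bullet> q' k) * q' k $ 4 \<ge> 0"
      by (rule same_sign(2)[OF one one k])
    also have "(principal_ray (A' 1) \<bullet> q' k) * q' k $ 4
        = (\<sigma> 1 * (principal_ray (A 1) \<bullet> q k)) * (e * q' k $ 4)"
      using sign(2)[OF one k] by (simp only: ray one k e_def) (simp add: power2_eq_square)
    finally show ?thesis
      using sign(1)[OF one k] by (simp only: zero_le_mult_iff) auto
  qed
  have *: "(e * d) * (e * q' k $ 4) = e\<^sup>2 * q k $ 4" if "k \<in> {1..n}" for k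
    by (simp add: q4[OF that] power2_eq_square)
  show "(\<forall>k\<in>{1..n}. q k $ 4 \<ge> 0) \<or> (\<forall>k\<in>{1..n}. q k $ 4 \<le> 0)"
  proof (cases "e * d \<ge> 0")
    case True
    then have "e\<^sup>2 * q k $ 4 \<ge> 0" if "k \<in> {1..n}" for k
      using nonneg[OF that] *[OF that] by (metis mult_nonneg_nonneg)
    then show ?thesis
      using \<open>e \<noteq> 0\<close> by (simp add: zero_le_mult_iff)
  next
    case False
    then have "e\<^sup>2 * q k $ 4 \<le> 0" if "k \<in> {1..n}" for k
      using nonneg[OF that] *[OF that] by (metis mult_nonpos_nonneg linear)
    then show ?thesis
      using \<open>e \<noteq> 0\<close> by (simp add: mult_le_0_iff)
  qed
qed

text \<open>
  The depths of \<open>q k\<close>, where defined, all have the same sign for all cameras and points. If it is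
  negative, the equivalence that changes the sign of the fourth coordinate reverses all depths
  at once; points at infinity are limits of points of positive depth in either case.
\<close>

lemma same_signs_imp_chiral_equivalent:
  assumes "n \<ge> 1" and "m \<ge> 1"
    and rec: "reconstruction m n p A q"
    and eucl: "euclidean_reconstruction m A"
    and signed: "signed_with m n \<sigma> A q"
    and \<sigma>: "\<And>i. i \<in> {1..m} \<Longrightarrow> \<sigma> i = \<sigma> 1"
    and q4: "(\<forall>k\<in>{1..n}. q k $ 4 \<ge> 0) \<or> (\<forall>k\<in>{1..n}. q k $ 4 \<le> 0)"
  shows "\<exists>A' q'. reconstruction m n p A' q' \<and> chiral m n A' q' \<and>
    euclidean_reconstruction m A' \<and> projectively_equivalent m n A' q' A q"
proof -
  have \<sigma>1: "(\<sigma> 1)\<^sup>2 = 1"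
    using signed_withD(2)[OF signed, of 1 1] \<open>n \<ge> 1\<close> \<open>m \<ge> 1\<close> by simp
  obtain e :: real where e: "e\<^sup>2 = 1" "\<And>k. k \<in> {1..n} \<Longrightarrow> e * q k $ 4 \<ge> 0"
    using q4
  proof
    assume "\<forall>k\<in>{1..n}. q k $ 4 \<ge> 0"
    then show ?thesis
      by (intro that[of 1]) auto
  next
    assume "\<forall>k\<in>{1..n}. q k $ 4 \<le> 0"
    then show ?thesis
      by (intro that[of "- 1"]) auto
  qed
  \<comment> \<open>After scaling by \<open>\<epsilon>\<close>, the sign \<open>e\<close> of the fourth coordinates becomes \<open>\<sigma> 1\<close>.\<close>
  define \<epsilon> where "\<epsilon> = \<sigma> 1 * e"
  define H where "H = scale4 \<epsilon>"
  have "\<epsilon>\<^sup>2 = 1"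
    using \<sigma>1 e by (simp add: \<epsilon>_def power_mult_distrib)
  then have HH: "H ** H = mat 1"
    by (simp add: H_def scale4_involution)
  then have "invertible H"
    by (auto simp: invertible_def)
  have "matrix_inv H = H"
    by (metis HH matrix_inv_mult(2)[OF \<open>invertible H\<close>] matrix_mul_assoc matrix_mul_lid matrix_mul_rid)
  define A' where "A' i = A i ** H" for i
  define q' where "q' k = H *v q k" for k
  have A'q': "A' i *v q' k = A i *v q k" for i k
    by (simp add: A'_def q'_def matrix_vector_mul_assoc matrix_mul_assoc[symmetric] HH)
  have Hq': "H *v q' k = q k" for k
    by (simp add: q'_def matrix_vector_mul_assoc HH)
  have q'0: "q' k \<noteq> 0" if "k \<in> {1..n}" for k
    using Hq'[of k] rec that by (auto simp: reconstruction_def)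
  have eu: "\<exists>R t. rotation_matrix R \<and> A i = block R t \<and> A' i = block R (\<epsilon> *\<^sub>R t)" if "i \<in> {1..m}" for i
    using euclidean_cameraE[OF eucl that] by (metis A'_def H_def block_scale4)
  then have eu': "euclidean_reconstruction m A'"
    unfolding euclidean_reconstruction_def by blast
  have cam: "finite_camera (A' i)" if "i \<in> {1..m}" for i
    using eu[OF that] by (auto simp: finite_camera_block rotation_matrix_def)
  have ray: "principal_ray (A' i) \<bullet> q' k = principal_ray (A i) \<bullet> q k" if "i \<in> {1..m}" for i k
    using eu[OF that] principal_ray_rotation A'q' by metis
  have "reconstruction m n p A' q'"
    using rec cam q'0 by (simp add: reconstruction_def A'q')
  moreover have "chiral m n A' q'"
    unfolding chiral_def
  proof
    fix k assume k: "k \<in> {1..n}"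
    show "proj_pt (q' k) \<in> chiral_domain (A' ` {1..m})"
    proof (rule chiral_domain_if_same_sign)
      show "\<sigma> 1 \<noteq> 0"
        using \<sigma>1 by auto
      have "\<sigma> 1 * q' k $ 4 = (\<sigma> 1)\<^sup>2 * (e * q k $ 4)"
        by (simp add: q'_def H_def scale4_mult \<epsilon>_def power2_eq_square)
      then show "\<sigma> 1 * q' k $ 4 \<ge> 0"
        using e(2)[OF k] \<sigma>1 by simp
      show "\<sigma> 1 * (principal_ray B \<bullet> q' k) > 0" if "B \<in> A' ` {1..m}" for B
        using that signed_withD(1)[OF signed _ k] ray \<sigma> by (metis imageE)
    qed (use cam q'0 k in auto)
  qed
  moreover have "projectively_equivalent m n A' q' A q"
    unfolding projectively_equivalent_def
    using \<open>invertible H\<close>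
    by (intro exI[of _ H]) (auto simp: A'_def q'_def \<open>matrix_inv H = H\<close> intro!: exI[of _ 1])
  ultimately show "\<exists>A' q'. reconstruction m n p A' q' \<and> chiral m n A' q' \<and>
      euclidean_reconstruction m A' \<and> projectively_equivalent m n A' q' A q"
    using eu' by blast
qed

theorem theorem11:
  fixes m n :: nat
    and p :: "nat \<Rightarrow> nat \<Rightarrow> real^2"
    and A :: "nat \<Rightarrow> real^4^3"
    and q :: "nat \<Rightarrow> real^4"
    and \<sigma> :: "nat \<Rightarrow> real"
  assumes "n \<ge> 1" and "m > 2"
    and "reconstruction m n p A q"
    and "euclidean_reconstruction m A"
    and "signed_with m n \<sigma> A q"
    and "\<forall>i\<in>{1..m}. \<forall>j\<in>{1..m}. i \<noteq> j \<longrightarrow> center (A i) \<noteq> center (A j)"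
    and "A 1 = block (mat 1) 0"
  shows "(\<exists>A' q'. reconstruction m n p A' q' \<and> chiral m n A' q' \<and> euclidean_reconstruction m A' \<and>
            projectively_equivalent m n A' q' A q)
     \<longleftrightarrow> (\<forall>i j. 1 \<le> i \<and> i < j \<and> j \<le> m \<longrightarrow> \<sigma> i = \<sigma> j) \<and>
         ((\<forall>k\<in>{1..n}. q k $ 4 \<ge> 0) \<or> (\<forall>k\<in>{1..n}. q k $ 4 \<le> 0))"
proof (intro iffI)
  assume "\<exists>A' q'. reconstruction m n p A' q' \<and> chiral m n A' q' \<and>
    euclidean_reconstruction m A' \<and> projectively_equivalent m n A' q' A q"
  then obtain A' q' where A'q': "reconstruction m n p A' q'" "chiral m n A' q'"
    "euclidean_reconstruction m A'" "projectively_equivalent m n A' q' A q"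
    by blast
  note signs = chiral_equivalent_imp_same_signs[OF assms(1,2,4-7) A'q']
  show "(\<forall>i j. 1 \<le> i \<and> i < j \<and> j \<le> m \<longrightarrow> \<sigma> i = \<sigma> j) \<and>
      ((\<forall>k\<in>{1..n}. q k $ 4 \<ge> 0) \<or> (\<forall>k\<in>{1..n}. q k $ 4 \<le> 0))"
    using signs(1) by (intro conjI signs(2)) auto
next
  assume R: "(\<forall>i j. 1 \<le> i \<and> i < j \<and> j \<le> m \<longrightarrow> \<sigma> i = \<sigma> j) \<and>
      ((\<forall>k\<in>{1..n}. q k $ 4 \<ge> 0) \<or> (\<forall>k\<in>{1..n}. q k $ 4 \<le> 0))"
  have \<sigma>: "\<sigma> i = \<sigma> 1" if "i \<in> {1..m}" for i
    using R that by (cases "i = 1") (auto simp: le_less)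
  have "m \<ge> 1"
    using assms(2) by simp
  from same_signs_imp_chiral_equivalent[OF assms(1) this assms(3-5) \<sigma> conjunct2[OF R]]
  show "\<exists>A' q'. reconstruction m n p A' q' \<and> chiral m n A' q' \<and>
      euclidean_reconstruction m A' \<and> projectively_equivalent m n A' q' A q"
    by simp
qed

end
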